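(* For every infinite dimensional complex Banach space $X$, $G_a(X)\geq 1/2$.
   Context: $X'$ denotes the topological dual of $X$. For a Dirichlet series $D=\sum_n a_n\frac1{n^s}$ with coefficients in a complex Banach space $X$ (variable $s\in\mathbb{C}$), set $\sigma_c(D):=\inf\{r\in\mathbb{R}:\sum_n a_n\frac1{n^s}\text{ converges in }X\text{ for all } s \text{ with }\operatorname{Re}s>r\}$ and $\sigma_a(D):=\inf\{r\in\mathbb{R}:\sum_n \|a_n\|\,|n^{-s}|<+\infty\text{ for all } s \text{ with }\operatorname{Re}s>r\}$, infima being taken in the extended real line. For $x'\in X'$, $x'(D):=\sum_n x'(a_n)\frac1{n^s}$ is a scalar Dirichlet series, and $\sigma_a^w(D):=\sup_{x'\in X'}\sigma_a(x'(D))$. The gap for absolute convergence of Dirichlet series in $X$ is $G_a(X):=\sup_D(\sigma_a(D)-\sigma_a^w(D))$, the supremum being over all Dirichlet series $D$ with coefficients in $X$ such that $\sigma_c(D)<+\infty$ (convention: the difference is taken to be $0$ when both abscissas are $-\infty$). *)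

theory Defs
  imports "HOL-Analysis.Analysis"
begin

text \<open>Complex Banach spaces. The inherited real structure is the one obtained by restriction of
  scalars; \<open>1 *\<^sub>C x = x\<close> follows from \<open>scaleR_scaleC\<close>.\<close>

class complex_banach = banach +
  fixes scaleC :: "complex \<Rightarrow> 'a \<Rightarrow> 'a"  (infixr "*\<^sub>C" 75)
  assumes scaleC_add_right: "c *\<^sub>C (x + y) = c *\<^sub>C x + c *\<^sub>C y"
    and scaleC_add_left: "(c + d) *\<^sub>C x = c *\<^sub>C x + d *\<^sub>C x"
    and scaleC_scaleC: "c *\<^sub>C (d *\<^sub>C x) = (c * d) *\<^sub>C x"
    and scaleR_scaleC: "r *\<^sub>R x = complex_of_real r *\<^sub>C x"
    and norm_scaleC: "norm (c *\<^sub>C x) = cmod c * norm x"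

lemma scaleC_one: "1 *\<^sub>C x = (x :: 'a :: complex_banach)"
  using scaleR_scaleC[of 1 x] by simp

lemma vector_space_scaleC: "vector_space (scaleC :: complex \<Rightarrow> 'a \<Rightarrow> 'a :: complex_banach)"
  by unfold_locales (simp_all add: scaleC_add_right scaleC_add_left scaleC_scaleC scaleC_one)

definition infinite_dimensional :: "'a :: complex_banach itself \<Rightarrow> bool" where
  "infinite_dimensional _ \<longleftrightarrow>
     \<not> (\<exists>B :: 'a set. finite B \<and> module.span scaleC B = UNIV)"

definition topological_dual :: "('a :: complex_banach \<Rightarrow> complex) set" where
  "topological_dual = {f. Vector_Spaces.linear scaleC (*) f \<and> continuous_on UNIV f}"

text \<open>A Dirichlet series is represented by its coefficients \<open>a 1, a 2, \<dots>\<close>; the value \<open>a 0\<close> is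
  never used.\<close>

definition sigma_c :: "(nat \<Rightarrow> 'a :: complex_banach) \<Rightarrow> ereal" where
  "sigma_c a = Inf {ereal r | r :: real. \<forall>s :: complex. Re s > r \<longrightarrow>
     summable (\<lambda>n. (1 / of_nat (Suc n) powr s) *\<^sub>C a (Suc n))}"

text \<open>Absolute convergence involves only the norm, so \<open>sigma_a\<close> is defined for all normed spaces and
  applies both to coefficients in the given space and to complex coefficients.\<close>

definition sigma_a :: "(nat \<Rightarrow> 'a :: real_normed_vector) \<Rightarrow> ereal" where
  "sigma_a a = Inf {ereal r | r :: real. \<forall>s :: complex. Re s > r \<longrightarrow>
     summable (\<lambda>n. norm (a (Suc n)) * cmod (of_nat (Suc n) powr (- s)))}"

definition sigma_a_weak :: "(nat \<Rightarrow> 'a :: complex_banach) \<Rightarrow> ereal" where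
  "sigma_a_weak a = (SUP f \<in> topological_dual. sigma_a (\<lambda>n. f (a n)))"

text \<open>The case distinction is needed because \<open>-\<infinity> - (-\<infinity>) = \<infinity>\<close> holds in type \<open>ereal\<close>.\<close>

definition abscissa_gap :: "(nat \<Rightarrow> 'a :: complex_banach) \<Rightarrow> ereal" where
  "abscissa_gap a =
     (if sigma_a a = -\<infinity> \<and> sigma_a_weak a = -\<infinity> then 0 else sigma_a a - sigma_a_weak a)"

definition gap_absolute :: "'a :: complex_banach itself \<Rightarrow> ereal" where
  "gap_absolute _ = (SUP a \<in> {a :: nat \<Rightarrow> 'a. sigma_c a < \<infinity>}. abscissa_gap a)"

end

theory Submission
  imports Defs "Jordan_Normal_Form.Determinant"
begin

text \<open>By a lemma of Dvoretzky--Rogers type, an infinite dimensional space contains for every \<open>k\<close>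
  vectors \<open>x\<^sub>0, \<dots>, x\<^sub>k\<^sub>-\<^sub>1\<close> of norm at least \<open>1/4\<close> such that \<open>t \<mapsto> \<Sum> t\<^sub>i x\<^sub>i\<close> is a contraction from
  \<open>l\<^sub>2\<close>. Filling the coefficients with indices in \<open>[2\<^sup>k, 2\<^sup>k\<^sup>+\<^sup>1)\<close> with such a system of length \<open>2\<^sup>k\<close> gives
  \<open>\<sigma>\<^sub>a = 1\<close>, while \<open>\<Sum> |x'(x\<^sub>i)| \<le> C 2\<^sup>k\<^sup>/\<^sup>2\<close> on each block forces \<open>\<sigma>\<^sub>a \<le> 1/2\<close> for every functional \<open>x'\<close>.

  For the lemma, take a \<open>2k\<close>-dimensional real subspace and a contraction \<open>l\<^sub>2 \<rightarrow> X\<close> into it whose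
  determinant is at least half the supremum. If the contraction had norm at most \<open>1/4\<close> on the
  orthogonal complement of fewer than \<open>k\<close> orthonormal vectors, then shrinking by \<open>1/\<surd>2\<close> on their span
  and stretching by \<open>\<surd>8\<close> on the complement would give another contraction with a determinant at
  least twice as large. So orthonormal vectors with images of norm at least \<open>1/4\<close> can be chosen one
  after the other.\<close>

subsection \<open>Rank one updates of determinants\<close>

lemma det_one_plus_rank_one:
  fixes U V :: "'a :: idom mat"
  assumes U: "U \<in> carrier_mat 1 n" and V: "V \<in> carrier_mat n 1"
  shows "Determinant.det (1\<^sub>m n + V * U) = 1 + (U * V) $$ (0, 0)"
proof -
  \<comment> \<open>Both sides are the determinant of \<open>?M\<close>, by its two block triangular factorisations.\<close>
  let ?M = "four_block_mat (1\<^sub>m 1) (- U) V (1\<^sub>m n)"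
  let ?L = "four_block_mat (1\<^sub>m 1) (0\<^sub>m 1 n) V (1\<^sub>m n)"
  let ?P = "four_block_mat (1\<^sub>m 1) (- U) (0\<^sub>m n 1) (1\<^sub>m n + V * U)"
  let ?Q = "four_block_mat (1\<^sub>m 1 + U * V) (- U) (0\<^sub>m n 1) (1\<^sub>m n)"
  have L: "?L \<in> carrier_mat (1 + n) (1 + n)" "?P \<in> carrier_mat (1 + n) (1 + n)"
    "?Q \<in> carrier_mat (1 + n) (1 + n)"
    using U V by auto
  have "V * (- U) + (1\<^sub>m n + V * U) = 1\<^sub>m n"
    using U V by (intro eq_matI) auto
  then have "?M = ?L * ?P"
    using U V by (subst mult_four_block_mat[of _ 1 1 _ n _ n _ _ 1 _ n]) auto
  then have 1: "Determinant.det ?M = Determinant.det (1\<^sub>m n + V * U)"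
    using det_mult[OF L(1,2)] U V
      det_four_block_mat_upper_right_zero[of "1\<^sub>m 1" 1 "0\<^sub>m 1 n" n V "1\<^sub>m n"]
      det_four_block_mat_lower_left_zero[of "1\<^sub>m 1" 1 "- U" n "0\<^sub>m n 1" "1\<^sub>m n + V * U"]
    by simp
  have "(1\<^sub>m 1 + U * V) + (- U) * V = 1\<^sub>m 1"
    using U V by (intro eq_matI) auto
  then have "?M = ?Q * ?L"
    using U V by (subst mult_four_block_mat[of _ 1 1 _ n _ n _ _ 1 _ n]) auto
  then have 2: "Determinant.det ?M = Determinant.det (1\<^sub>m 1 + U * V)"
    using det_mult[OF L(3,1)] U V
      det_four_block_mat_upper_right_zero[of "1\<^sub>m 1" 1 "0\<^sub>m 1 n" n V "1\<^sub>m n"]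
      det_four_block_mat_lower_left_zero[of "1\<^sub>m 1 + U * V" 1 "- U" n "0\<^sub>m n 1" "1\<^sub>m n"]
    by simp
  show ?thesis
    using 1 2 U V by (simp add: det_single)
qed

text \<open>The updated matrix is \<open>G (1 + c e e^T)\<close>: its column \<open>j\<close> gains
  \<open>c * e j\<close> times the vector \<open>G e\<close>. This is how stretching along
  \<open>e\<close> before applying a linear map changes the determinant.\<close>

lemma det_rank_one_update:
  fixes G :: "nat \<Rightarrow> nat \<Rightarrow> 'a :: idom"
  shows "Determinant.det (Matrix.mat n n (\<lambda>(i, j). G i j + c * e j * (\<Sum>k<n. e k * G i k))) =
    (1 + c * (\<Sum>k<n. e k * e k)) * Determinant.det (Matrix.mat n n (\<lambda>(i, j). G i j))"
proof -
  let ?G = "Matrix.mat n n (\<lambda>(i, j). G i j)"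
  let ?V = "Matrix.mat n 1 (\<lambda>(i, j). c * e i)"
  let ?U = "Matrix.mat 1 n (\<lambda>(i, j). e j)"
  have "Matrix.mat n n (\<lambda>(i, j). G i j + c * e j * (\<Sum>k<n. e k * G i k)) = ?G * (1\<^sub>m n + ?V * ?U)"
  proof (intro eq_matI)
    fix i j assume "i < dim_row (?G * (1\<^sub>m n + ?V * ?U))" "j < dim_col (?G * (1\<^sub>m n + ?V * ?U))"
    then have ij: "i < n" "j < n" by auto
    have "(?G * (1\<^sub>m n + ?V * ?U)) $$ (i, j) = (\<Sum>k<n. G i k * ((if k = j then 1 else 0) + c * e k * e j))"
      using ij by (simp add: scalar_prod_def lessThan_atLeast0)
    also have "\<dots> = (\<Sum>k<n. (if k = j then G i k else 0) + c * e j * (e k * G i k))"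
      by (intro sum.cong) (auto simp: algebra_simps)
    also have "\<dots> = G i j + c * e j * (\<Sum>k<n. e k * G i k)"
      using ij by (simp add: sum.distrib sum_distrib_left)
    finally show "Matrix.mat n n (\<lambda>(i, j). G i j + c * e j * (\<Sum>k<n. e k * G i k)) $$ (i, j) =
        (?G * (1\<^sub>m n + ?V * ?U)) $$ (i, j)"
      using ij by simp
  qed auto
  moreover have "(?U * ?V) $$ (0, 0) = c * (\<Sum>k<n. e k * e k)"
    by (simp add: scalar_prod_def lessThan_atLeast0 sum_distrib_left mult_ac)
  moreover have "Determinant.det (?G * (1\<^sub>m n + ?V * ?U)) =
      Determinant.det ?G * (1 + (?U * ?V) $$ (0, 0))"
    by (subst det_mult[of _ n], (intro add_carrier_mat mult_carrier_mat[of _ n 1] one_carrier_mat mat_carrier)+)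
      (subst det_one_plus_rank_one[OF mat_carrier mat_carrier], rule refl)
  ultimately show ?thesis
    by (simp only: mult.commute)
qed

text \<open>The Leibniz formula has \<open>n!\<close> terms, each a signed product of
  \<open>n\<close> entries.\<close>

lemma abs_det_le:
  fixes f :: "nat \<Rightarrow> nat \<Rightarrow> real"
  assumes "\<And>i j. i < n \<Longrightarrow> j < n \<Longrightarrow> \<bar>f i j\<bar> \<le> M"
  shows "\<bar>Determinant.det (Matrix.mat n n (\<lambda>(i, j). f i j))\<bar> \<le> fact n * M ^ n"
proof -
  let ?P = "{p. p permutes {0..<n}}"
  have "\<bar>Determinant.det (Matrix.mat n n (\<lambda>(i, j). f i j))\<bar>
      = \<bar>\<Sum>p\<in>?P. signof p * (\<Prod>i = 0..<n. Matrix.mat n n (\<lambda>(i, j). f i j) $$ (i, p i))\<bar>"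
    by (subst det_def'[of _ n]) auto
  also have "\<dots> \<le> (\<Sum>p\<in>?P. M ^ n)"
  proof (rule sum_abs[THEN order_trans], rule sum_mono)
    fix p assume p: "p \<in> ?P"
    have "\<bar>\<Prod>i = 0..<n. Matrix.mat n n (\<lambda>(i, j). f i j) $$ (i, p i)\<bar> \<le> (\<Prod>i = 0..<n. M)"
      unfolding abs_prod
    proof (rule prod_mono)
      fix i assume "i \<in> {0..<n}"
      then have "i < n" "p i < n"
        using p permutes_in_image[of p "{0..<n}" i] by auto
      then show "0 \<le> \<bar>Matrix.mat n n (\<lambda>(i, j). f i j) $$ (i, p i)\<bar> \<and>
          \<bar>Matrix.mat n n (\<lambda>(i, j). f i j) $$ (i, p i)\<bar> \<le> M"
        using assms by simp
    qed
    then show "\<bar>signof p * (\<Prod>i = 0..<n. Matrix.mat n n (\<lambda>(i, j). f i j) $$ (i, p i))\<bar> \<le> M ^ n"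
      by (simp add: abs_mult sign_def)
  qed
  also have "\<dots> = fact n * M ^ n"
    by (simp add: card_permutations[of _ n])
  finally show ?thesis .
qed

subsection \<open>Volume forms on finite dimensional subspaces\<close>

text \<open>Induction on the basis. Bounded coordinates make the smaller span closed, so a new basis
  vector has positive distance from it, and this distance controls the new coordinate.\<close>

lemma bounded_coordinates:
  fixes B :: "'a :: real_normed_vector set"
  assumes "finite B" "independent B"
  shows "\<exists>M. \<forall>v\<in>span B. \<forall>b\<in>B. \<bar>representation B v b\<bar> \<le> M * norm v"
  using assms
proof (induction B rule: finite_induct)
  case empty
  then show ?case by auto
next
  case (insert b B)
  have ind: "independent B" and b: "b \<notin> span B"
    using insert.prems insert.hyps by (auto simp: independent_insert)
  obtain M where M: "\<And>v c. v \<in> span B \<Longrightarrow> c \<in> B \<Longrightarrow> \<bar>representation B v c\<bar> \<le> M * norm v"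
    using insert.IH[OF ind] by auto
  have "closed (span B)"
  proof (unfold closed_sequential_limits, intro allI impI, elim conjE)
    fix x l assume x: "\<forall>n. x n \<in> span B" and l: "x \<longlonglongrightarrow> l"
    have "convergent (\<lambda>n. representation B (x n) c)" if c: "c \<in> B" for c
    proof -
      \<comment> \<open>Scaling by \<open>M\<close> avoids a division by \<open>M\<close>, whose
        sign is not known.\<close>
      have "Cauchy (\<lambda>n. M *\<^sub>R x n)"
        by (rule LIMSEQ_imp_Cauchy[OF tendsto_scaleR[OF tendsto_const l]])
      then have "Cauchy (\<lambda>n. representation B (x n) c)"
        unfolding Cauchy_def
      proof (elim all_forward imp_forward ex_forward)
        fix e :: real and m n
        assume "dist (M *\<^sub>R x m) (M *\<^sub>R x n) < e"
        moreover have "dist (representation B (x m) c) (representation B (x n) c) \<le> M * norm (x m - x n)"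
          using M[of "x m - x n" c] c x ind by (simp add: dist_real_def representation_diff span_diff)
        moreover have "M * norm (x m - x n) \<le> dist (M *\<^sub>R x m) (M *\<^sub>R x n)"
          by (simp add: dist_norm mult_right_mono flip: scaleR_diff_right)
        ultimately show "dist (representation B (x m) c) (representation B (x n) c) < e"
          by linarith
      qed
      then show ?thesis by (rule Cauchy_convergent)
    qed
    then obtain r where r: "\<And>c. c \<in> B \<Longrightarrow> (\<lambda>n. representation B (x n) c) \<longlonglongrightarrow> r c"
      unfolding convergent_def by metis
    have "(\<lambda>n. \<Sum>c\<in>B. representation B (x n) c *\<^sub>R c) \<longlonglongrightarrow> (\<Sum>c\<in>B. r c *\<^sub>R c)"
      by (intro tendsto_intros r)
    moreover have "(\<Sum>c\<in>B. representation B (x n) c *\<^sub>R c) = x n" for n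
      using ind x insert.hyps by (intro real_vector.sum_representation_eq) auto
    ultimately have "l = (\<Sum>c\<in>B. r c *\<^sub>R c)"
      using l LIMSEQ_unique by simp
    then show "l \<in> span B"
      by (simp add: span_sum span_scale span_base)
  qed
  then obtain d where d: "d > 0" "ball b d \<subseteq> - span B"
    using b open_contains_ball[of "- span B"] by (auto simp: open_closed)
  have d_le: "d \<le> norm (b - w)" if "w \<in> span B" for w
    using d(2) that by (auto simp: subset_iff dist_norm not_less[symmetric])
  have "\<bar>representation (insert b B) v c\<bar> \<le> (1 / d + \<bar>M\<bar> * (1 + norm b / d)) * norm v"
    if v: "v \<in> span (insert b B)" and c: "c \<in> insert b B" for v c
  proof -
    obtain k where w: "v - k *\<^sub>R b \<in> span B"
      using v real_vector.span_breakdown_eq by blast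
    define w where "w = v - k *\<^sub>R b"
    have veq: "v = k *\<^sub>R b + w" and wB: "w \<in> span B" and wB': "w \<in> span (insert b B)"
      using w span_mono[of B "insert b B"] by (auto simp: w_def)
    have rep: "representation (insert b B) v c = k * (if b = c then 1 else 0) + representation B w c"
      using insert.prems wB wB' ind
      by (simp add: veq representation_add representation_scale representation_basis span_base span_scale
          representation_extend[of "insert b B" w B] subset_insertI)
    have k: "\<bar>k\<bar> * d \<le> norm v"
    proof (cases "k = 0")
      case False
      \<comment> \<open>Dividing \<open>v = k b + w\<close> by \<open>k\<close> exhibits
        \<open>v / k\<close> as \<open>b\<close> minus a point of \<open>span B\<close>, so its norm
        is at least the distance \<open>d\<close>.\<close>
      have "d \<le> norm (b - (- (1 / k)) *\<^sub>R w)"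
        using wB by (intro d_le span_scale)
      also have "b - (- (1 / k)) *\<^sub>R w = (1 / k) *\<^sub>R v"
        using False by (simp add: veq scaleR_add_right)
      finally show ?thesis
        using False by (simp add: field_simps)
    qed simp
    then have k': "\<bar>k\<bar> \<le> norm v / d"
      using d by (simp add: field_simps)
    have "norm w \<le> norm v + \<bar>k\<bar> * norm b"
      unfolding w_def by (metis norm_scaleR norm_triangle_ineq4)
    also have "\<dots> \<le> norm v + norm v / d * norm b"
      using k' by (intro add_left_mono mult_right_mono) auto
    finally have w_le: "norm w \<le> (1 + norm b / d) * norm v"
      by (simp add: field_simps)
    have "\<bar>representation B w c\<bar> \<le> \<bar>M\<bar> * norm w"
    proof (cases "c \<in> B")
      case True
      then have "\<bar>representation B w c\<bar> \<le> M * norm w"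
        using M wB by simp
      also have "\<dots> \<le> \<bar>M\<bar> * norm w"
        by (intro mult_right_mono) auto
      finally show ?thesis .
    next
      case False
      then have "representation B w c = 0"
        using real_vector.representation_ne_zero by blast
      then show ?thesis by simp
    qed
    also have "\<dots> \<le> \<bar>M\<bar> * ((1 + norm b / d) * norm v)"
      using w_le by (intro mult_left_mono) auto
    finally have "\<bar>representation (insert b B) v c\<bar> \<le> norm v / d + \<bar>M\<bar> * ((1 + norm b / d) * norm v)"
      using k' unfolding rep by (auto simp: abs_mult intro!: abs_triangle_ineq[THEN order_trans] add_mono)
    then show ?thesis
      by (simp add: algebra_simps)
  qed
  then show ?case by blast
qed

text \<open>Models the determinant of the linear map sending the unit vectors to \<open>y j\<close>,
  through its behaviour under composition with \<open>1 + c e e^T\<close> and with scalars.\<close>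

definition volume_form :: "nat \<Rightarrow> 'a :: real_vector set \<Rightarrow> ((nat \<Rightarrow> 'a) \<Rightarrow> real) \<Rightarrow> bool" where
  "volume_form n V D \<longleftrightarrow>
     (\<forall>y c e. (\<forall>j<n. y j \<in> V) \<longrightarrow>
       D (\<lambda>j. y j + (c * e j) *\<^sub>R (\<Sum>k<n. e k *\<^sub>R y k)) = (1 + c * (\<Sum>k<n. e k * e k)) * D y) \<and>
     (\<forall>y r. (\<forall>j<n. y j \<in> V) \<longrightarrow> D (\<lambda>j. r *\<^sub>R y j) = r ^ n * D y)"

lemma volume_form_rank_one:
  assumes "volume_form n V D" "\<And>j. j < n \<Longrightarrow> y j \<in> V"
  shows "D (\<lambda>j. y j + (c * e j) *\<^sub>R (\<Sum>k<n. e k *\<^sub>R y k)) = (1 + c * (\<Sum>k<n. e k * e k)) * D y"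
  using assms by (auto simp: volume_form_def)

lemma volume_form_scale:
  assumes "volume_form n V D" "\<And>j. j < n \<Longrightarrow> y j \<in> V"
  shows "D (\<lambda>j. r *\<^sub>R y j) = r ^ n * D y"
  using assms by (auto simp: volume_form_def)

text \<open>\<open>D\<close> is the determinant of the coordinates with respect to \<open>B\<close>.
  Bounded coordinates give \<open>C\<close>, and \<open>B\<close> itself, with the identity as its
  matrix, serves as \<open>y0\<close>. The bound makes a supremum over contractions finite, and
  \<open>y0\<close> makes it positive.\<close>

lemma ex_volume_form:
  fixes B :: "'a :: real_normed_vector set"
  assumes B: "finite B" "independent B" and n: "card B = n"
  obtains D C y0 where "volume_form n (span B) D"
    "\<forall>y. (\<forall>j<n. y j \<in> span B \<and> norm (y j) \<le> 1) \<longrightarrow> \<bar>D y\<bar> \<le> C"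
    "\<forall>j<n. y0 j \<in> span B" "D y0 = 1"
proof -
  obtain b where b: "bij_betw b {..<n} B"
    using B n ex_bij_betw_nat_finite[of B] by (auto simp: lessThan_atLeast0)
  define D where "D y = Determinant.det (Matrix.mat n n (\<lambda>(i, j). representation B (y j) (b i)))" for y
  have D_cong: "D y = Determinant.det (Matrix.mat n n (\<lambda>(i, j). f i j))"
    if "\<And>i j. i < n \<Longrightarrow> j < n \<Longrightarrow> representation B (y j) (b i) = f i j" for y f
    unfolding D_def using that by (intro arg_cong[of _ _ Determinant.det] eq_matI) auto
  obtain M where M: "\<And>v c. v \<in> span B \<Longrightarrow> c \<in> B \<Longrightarrow> \<bar>representation B v c\<bar> \<le> M * norm v"
    using bounded_coordinates[OF B] by auto
  have bB: "b i \<in> B" if "i < n" for i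
    using b that by (auto simp: bij_betw_def)
  have vol: "volume_form n (span B) D"
    unfolding volume_form_def
  proof (intro conjI allI impI)
    fix y :: "nat \<Rightarrow> 'a" and c :: real and e :: "nat \<Rightarrow> real"
    assume y: "\<forall>j<n. y j \<in> span B"
    define G where "G i j = representation B (y j) (b i)" for i j
    define z where "z = (\<Sum>k<n. e k *\<^sub>R y k)"
    have in_span: "e k *\<^sub>R y k \<in> span B" if "k < n" for k
      using y that by (auto intro: span_scale)
    have zB: "z \<in> span B"
      unfolding z_def using in_span by (intro span_sum) auto
    have rep_z: "representation B z (b i) = (\<Sum>k<n. e k * G i k)" for i
      using B(2) y in_span unfolding G_def z_def
      by (subst representation_sum) (auto simp: representation_scale)
    have "representation B (y j + (c * e j) *\<^sub>R z) (b i) =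
        G i j + c * e j * (\<Sum>k<n. e k * G i k)" if "j < n" for i j
      using representation_add[OF B(2) span_scale[OF zB, of "c * e j"] y[rule_format, OF that]]
        representation_scale[OF B(2) zB, of "c * e j"] rep_z
      by (simp add: G_def)
    then have "D (\<lambda>j. y j + (c * e j) *\<^sub>R z) =
        Determinant.det (Matrix.mat n n (\<lambda>(i, j). G i j + c * e j * (\<Sum>k<n. e k * G i k)))"
      by (intro D_cong) simp
    then show "D (\<lambda>j. y j + (c * e j) *\<^sub>R (\<Sum>k<n. e k *\<^sub>R y k)) = (1 + c * (\<Sum>k<n. e k * e k)) * D y"
      unfolding det_rank_one_update by (simp add: G_def D_def z_def)
  next
    fix y :: "nat \<Rightarrow> 'a" and r :: real
    assume y: "\<forall>j<n. y j \<in> span B"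
    let ?A = "Matrix.mat n n (\<lambda>(i, j). representation B (y j) (b i))"
    have "D (\<lambda>j. r *\<^sub>R y j) = Determinant.det (r \<cdot>\<^sub>m ?A)"
      unfolding D_def using B(2) y
      by (intro arg_cong[of _ _ Determinant.det] eq_matI) (auto simp: representation_scale)
    then show "D (\<lambda>j. r *\<^sub>R y j) = r ^ n * D y"
      by (simp add: D_def)
  qed
  have bound: "\<bar>D y\<bar> \<le> fact n * \<bar>M\<bar> ^ n" if y: "\<forall>j<n. y j \<in> span B \<and> norm (y j) \<le> 1" for y
    unfolding D_def
  proof (rule abs_det_le)
    fix i j assume ij: "i < n" "j < n"
    have "\<bar>representation B (y j) (b i)\<bar> \<le> M * norm (y j)"
      using M y bB ij by blast
    also have "\<dots> \<le> \<bar>M\<bar> * 1"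
      using y ij by (intro mult_mono) auto
    finally show "\<bar>representation B (y j) (b i)\<bar> \<le> \<bar>M\<bar>" by simp
  qed
  have "D b = Determinant.det (Matrix.mat n n (\<lambda>(i, j). if i = j then 1 else 0))"
    using b by (intro D_cong)
      (auto simp: representation_basis[OF B(2) bB] bij_betw_def inj_on_eq_iff)
  also have "Matrix.mat n n (\<lambda>(i, j). if i = j then 1 else 0 :: real) = 1\<^sub>m n"
    by (intro eq_matI) auto
  finally have "D b = 1" by simp
  moreover have "\<forall>j<n. b j \<in> span B"
    using bB by (blast intro: span_base)
  ultimately show ?thesis
    using that vol bound by blast
qed

subsection \<open>A Dvoretzky--Rogers lemma\<close>

definition l2_contractive :: "nat \<Rightarrow> (nat \<Rightarrow> 'a :: real_normed_vector) \<Rightarrow> bool" where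
  "l2_contractive n y \<longleftrightarrow> (\<forall>t. norm (\<Sum>i<n. t i *\<^sub>R y i) \<le> sqrt (\<Sum>i<n. (t i)\<^sup>2))"

lemma l2_contractiveD:
  "l2_contractive n y \<Longrightarrow> norm (\<Sum>i<n. t i *\<^sub>R y i) \<le> sqrt (\<Sum>i<n. (t i)\<^sup>2)"
  by (simp add: l2_contractive_def)

lemma l2_contractive_norm_le:
  assumes "l2_contractive n y" "i < n"
  shows "norm (y i) \<le> 1"
proof -
  have "(\<Sum>j<n. (if j = i then 1 else 0) *\<^sub>R y j) = y i"
    using assms by (simp add: if_distrib[of "\<lambda>c. c *\<^sub>R _"] cong: if_cong)
  moreover have "(\<Sum>j<n. (if j = i then 1 else 0 :: real)\<^sup>2) = 1"
    using assms by (simp add: if_distrib[of "\<lambda>c. c\<^sup>2"] cong: if_cong)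
  ultimately show ?thesis
    using l2_contractiveD[OF assms(1), of "\<lambda>j. if j = i then 1 else 0"] by simp
qed

section \<open>Orthonormal families and deformations along them\<close>

definition orthonormal_family :: "nat \<Rightarrow> nat \<Rightarrow> (nat \<Rightarrow> nat \<Rightarrow> real) \<Rightarrow> bool" where
  "orthonormal_family n m e \<longleftrightarrow>
     (\<forall>l<m. \<forall>l'<m. (\<Sum>i<n. e l i * e l' i) = (if l = l' then 1 else 0))"

lemma orthonormal_family_combination:
  assumes "orthonormal_family n m e" and "l < m"
  shows "(\<Sum>i<n. (\<Sum>l'<m. t l' * e l' i) * e l i) = t l"
proof -
  have "(\<Sum>i<n. (\<Sum>l'<m. t l' * e l' i) * e l i) = (\<Sum>l'<m. t l' * (\<Sum>i<n. e l' i * e l i))"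
    unfolding sum_distrib_right sum_distrib_left by (subst sum.swap) (simp add: mult_ac)
  also have "\<dots> = (\<Sum>l'<m. if l' = l then t l' else 0)"
    using assms by (intro sum.cong) (auto simp: orthonormal_family_def)
  finally show ?thesis using assms by simp
qed

text \<open>By orthonormality, \<open>1 + c * (sum of e_l e_l^T)\<close> is the product of the
  factors \<open>1 + c e_l e_l^T\<close>, each of determinant \<open>1 + c\<close>; the induction
  splits off one factor at a time.\<close>

lemma volume_orthonormal_update:
  assumes D: "volume_form n (span B) D"
    and y: "\<And>j. j < n \<Longrightarrow> y j \<in> span B"
    and e: "orthonormal_family n m e"
  shows "D (\<lambda>j. y j + (\<Sum>l<m. (c * e l j) *\<^sub>R (\<Sum>k<n. e l k *\<^sub>R y k))) = (1 + c) ^ m * D y"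
  using e
proof (induction m)
  case 0
  then show ?case by simp
next
  case (Suc m)
  define z where "z l = (\<Sum>k<n. e l k *\<^sub>R y k)" for l
  define y' where "y' j = y j + (\<Sum>l<m. (c * e l j) *\<^sub>R z l)" for j
  have zB: "z l \<in> span B" for l
    unfolding z_def using y by (auto intro!: span_sum span_scale)
  have y'B: "y' j \<in> span B" if "j < n" for j
    unfolding y'_def using y that zB by (auto intro!: span_add span_sum span_scale)
  \<comment> \<open>The earlier updates act along vectors orthogonal to \<open>e m\<close>, so they
    leave the image \<open>z m\<close> of \<open>e m\<close> unchanged.\<close>
  have "(\<Sum>k<n. e m k *\<^sub>R y' k) = z m + (\<Sum>k<n. e m k *\<^sub>R (\<Sum>l<m. (c * e l k) *\<^sub>R z l))"
    by (simp add: y'_def z_def scaleR_add_right sum.distrib)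
  also have "(\<Sum>k<n. e m k *\<^sub>R (\<Sum>l<m. (c * e l k) *\<^sub>R z l)) =
      (\<Sum>k<n. \<Sum>l<m. (c * (e m k * e l k)) *\<^sub>R z l)"
    by (simp add: scaleR_sum_right mult_ac)
  also have "\<dots> = (\<Sum>l<m. (c * (\<Sum>k<n. e m k * e l k)) *\<^sub>R z l)"
    by (subst sum.swap) (simp add: scaleR_sum_left sum_distrib_left)
  also have "\<dots> = 0"
    using Suc.prems by (intro sum.neutral) (auto simp: orthonormal_family_def)
  finally have z: "(\<Sum>k<n. e m k *\<^sub>R y' k) = z m" by simp
  have "D (\<lambda>j. y j + (\<Sum>l<Suc m. (c * e l j) *\<^sub>R z l)) = D (\<lambda>j. y' j + (c * e m j) *\<^sub>R z m)"
    by (simp add: y'_def add.assoc)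
  also have "\<dots> = (1 + c) * D y'"
    using volume_form_rank_one[OF D, of y' c "e m"] y'B z Suc.prems by (simp add: orthonormal_family_def)
  also have "D y' = (1 + c) ^ m * D y"
    unfolding y'_def z_def using Suc.prems by (intro Suc.IH) (auto simp: orthonormal_family_def)
  finally show ?case
    by (simp add: z_def mult_ac)
qed

text \<open>The new family represents \<open>y \<circ> R\<close>, where \<open>R\<close> is \<open>\<surd>8 (1 - 3/4) = 1/\<surd>2\<close> on the span of the \<open>e l\<close>
  and \<open>\<surd>8\<close> on the orthogonal complement.\<close>

lemma l2_contractive_stretch:
  assumes y: "l2_contractive n y" and e: "orthonormal_family n m e"
    and small: "\<And>q. (\<And>l. l < m \<Longrightarrow> (\<Sum>i<n. q i * e l i) = 0) \<Longrightarrow>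
      norm (\<Sum>i<n. q i *\<^sub>R y i) \<le> 1 / 4 * sqrt (\<Sum>i<n. (q i)\<^sup>2)"
  shows "l2_contractive n
    (\<lambda>j. sqrt 8 *\<^sub>R (y j + (\<Sum>l<m. (- (3 / 4) * e l j) *\<^sub>R (\<Sum>k<n. e l k *\<^sub>R y k))))"
  unfolding l2_contractive_def
proof
  fix t :: "nat \<Rightarrow> real"
  \<comment> \<open>Here \<open>p\<close> is the orthogonal projection of \<open>t\<close> onto the
    span of the \<open>e l\<close>, and \<open>q\<close> is the orthogonal remainder;
    \<open>P\<close> and \<open>Q\<close> are their images, \<open>u\<close> and \<open>v\<close>
    their Euclidean norms.\<close>
  define \<tau> where "\<tau> l = (\<Sum>i<n. t i * e l i)" for l
  define p where "p i = (\<Sum>l<m. \<tau> l * e l i)" for i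
  define q where "q i = t i - p i" for i
  define z where "z l = (\<Sum>k<n. e l k *\<^sub>R y k)" for l
  define P where "P = (\<Sum>i<n. p i *\<^sub>R y i)"
  define Q where "Q = (\<Sum>i<n. q i *\<^sub>R y i)"
  define u where "u = sqrt (\<Sum>i<n. (p i)\<^sup>2)"
  define v where "v = sqrt (\<Sum>i<n. (q i)\<^sup>2)"
  have orth: "(\<Sum>i<n. q i * e l i) = 0" if "l < m" for l
    using orthonormal_family_combination[OF e that, of \<tau>]
    by (simp add: q_def p_def \<tau>_def left_diff_distrib sum_subtractf)
  have "(\<Sum>i<n. p i * q i) = (\<Sum>l<m. \<tau> l * (\<Sum>i<n. q i * e l i))"
    unfolding p_def sum_distrib_left sum_distrib_right by (subst sum.swap) (simp add: mult_ac)
  then have pq: "(\<Sum>i<n. p i * q i) = 0"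
    using orth by simp
  have "(\<Sum>i<n. (t i)\<^sup>2) = (\<Sum>i<n. (p i)\<^sup>2 + (q i)\<^sup>2 + 2 * (p i * q i))"
    by (intro sum.cong) (auto simp: q_def power2_eq_square algebra_simps)
  also have "\<dots> = u\<^sup>2 + v\<^sup>2"
    using pq by (simp add: u_def v_def sum.distrib sum_nonneg flip: sum_distrib_left)
  finally have t: "(\<Sum>i<n. (t i)\<^sup>2) = u\<^sup>2 + v\<^sup>2" .
  have P: "P = (\<Sum>l<m. \<tau> l *\<^sub>R z l)"
    unfolding P_def p_def z_def scaleR_sum_left scaleR_sum_right by (subst sum.swap) simp
  have T: "(\<Sum>i<n. t i *\<^sub>R y i) = P + Q"
    by (simp add: P_def Q_def q_def flip: sum.distrib scaleR_add_left)
  have "(\<Sum>i<n. t i *\<^sub>R (\<Sum>l<m. (- (3 / 4) * e l i) *\<^sub>R z l)) = (\<Sum>l<m. (- (3 / 4) * \<tau> l) *\<^sub>R z l)"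
    unfolding \<tau>_def scaleR_sum_left scaleR_sum_right sum_distrib_left
    by (subst sum.swap) (simp add: mult_ac)
  also have "\<dots> = - (3 / 4) *\<^sub>R P"
    unfolding P scaleR_sum_right by simp
  finally have R: "(\<Sum>i<n. t i *\<^sub>R (\<Sum>l<m. (- (3 / 4) * e l i) *\<^sub>R z l)) = - (3 / 4) *\<^sub>R P" .
  have "(\<Sum>i<n. t i *\<^sub>R (sqrt 8 *\<^sub>R (y i + (\<Sum>l<m. (- (3 / 4) * e l i) *\<^sub>R z l)))) =
      sqrt 8 *\<^sub>R ((\<Sum>i<n. t i *\<^sub>R y i) + (\<Sum>i<n. t i *\<^sub>R (\<Sum>l<m. (- (3 / 4) * e l i) *\<^sub>R z l)))"
    unfolding scaleR_sum_right[of "sqrt 8"] scaleR_add_right sum.distrib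
    by (simp add: mult_ac scaleR_sum_right)
  also have "\<dots> = sqrt 8 *\<^sub>R (Q + (1 / 4) *\<^sub>R P)"
  proof -
    have "P + Q + - (3 / 4) *\<^sub>R P = Q + (1 - 3 / 4) *\<^sub>R P"
      unfolding scaleR_diff_left by simp
    then show ?thesis unfolding T R by simp
  qed
  finally have eq: "(\<Sum>i<n. t i *\<^sub>R (sqrt 8 *\<^sub>R (y i + (\<Sum>l<m. (- (3 / 4) * e l i) *\<^sub>R z l)))) =
      sqrt 8 *\<^sub>R (Q + (1 / 4) *\<^sub>R P)" .
  have "norm (Q + (1 / 4) *\<^sub>R P) \<le> norm Q + 1 / 4 * norm P"
    by (metis norm_scaleR norm_triangle_ineq abs_of_nonneg zero_le_divide_1_iff zero_le_numeral)
  also have "\<dots> \<le> 1 / 4 * v + 1 / 4 * u"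
    unfolding u_def v_def P_def Q_def
    by (intro add_mono mult_left_mono small orth l2_contractiveD[OF y]) auto
  finally have "sqrt 8 * norm (Q + (1 / 4) *\<^sub>R P) \<le> sqrt 8 * ((u + v) / 4)"
    by (intro mult_left_mono) auto
  \<comment> \<open>Since \<open>sqrt 8 / 4 = 1 / sqrt 2\<close>, this is the Cauchy-Schwarz
    inequality for \<open>u + v\<close>.\<close>
  also have "\<dots> \<le> sqrt (u\<^sup>2 + v\<^sup>2)"
  proof (rule real_le_rsqrt)
    have "(sqrt 8 * ((u + v) / 4))\<^sup>2 = (u + v)\<^sup>2 / 2"
      by (simp add: power_mult_distrib power_divide)
    also have "\<dots> \<le> u\<^sup>2 + v\<^sup>2"
      using zero_le_power2[of "u - v"] by (simp add: power2_eq_square algebra_simps)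
    finally show "(sqrt 8 * ((u + v) / 4))\<^sup>2 \<le> u\<^sup>2 + v\<^sup>2" .
  qed
  finally show "norm (\<Sum>i<n. t i *\<^sub>R (sqrt 8 *\<^sub>R (y i +
      (\<Sum>l<m. (- (3 / 4) * e l i) *\<^sub>R (\<Sum>k<n. e l k *\<^sub>R y k))))) \<le> sqrt (\<Sum>i<n. (t i)\<^sup>2)"
    using eq t unfolding z_def by simp
qed

section \<open>Extraction of vectors with large images\<close>

lemma infinite_dimensional_independent:
  assumes "\<nexists>B :: 'a :: real_normed_vector set. finite B \<and> span B = UNIV"
  obtains B :: "'a :: real_normed_vector set" where "finite B" "independent B" "card B = n"
proof -
  obtain A :: "'a set" where A: "independent A" "span A = UNIV"
    using real_vector.independent_extend_basis[OF real_vector.independent_empty]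
      real_vector.span_extend_basis[OF real_vector.independent_empty] by blast
  then have "infinite A"
    using assms by blast
  then obtain B where "B \<subseteq> A" "finite B" "card B = n"
    using infinite_arbitrarily_large by blast
  then show ?thesis
    using A that real_vector.independent_mono by blast
qed

text \<open>Sending \<open>t\<close> to the combination of the \<open>e l\<close> with coefficients
  \<open>t l\<close> is an isometry between Euclidean spaces, and composing the contraction with it
  keeps it contractive.\<close>

lemma l2_contractive_combination:
  assumes y: "l2_contractive n y" and e: "orthonormal_family n m e"
  shows "l2_contractive m (\<lambda>l. \<Sum>i<n. e l i *\<^sub>R y i)"
  unfolding l2_contractive_def
proof
  fix t :: "nat \<Rightarrow> real"
  define p where "p i = (\<Sum>l<m. t l * e l i)" for i
  have "(\<Sum>l<m. t l *\<^sub>R (\<Sum>i<n. e l i *\<^sub>R y i)) = (\<Sum>i<n. p i *\<^sub>R y i)"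
    unfolding p_def scaleR_sum_left scaleR_sum_right by (subst sum.swap) simp
  moreover have "(\<Sum>i<n. (p i)\<^sup>2) = (\<Sum>l<m. (t l)\<^sup>2)"
  proof -
    have "(\<Sum>i<n. (p i)\<^sup>2) = (\<Sum>i<n. \<Sum>l<m. p i * (t l * e l i))"
      by (simp only: power2_eq_square sum_distrib_left[symmetric] p_def[symmetric])
    also have "\<dots> = (\<Sum>l<m. t l * (\<Sum>i<n. p i * e l i))"
      by (subst sum.swap) (simp add: sum_distrib_left mult.left_commute)
    also have "\<dots> = (\<Sum>l<m. (t l)\<^sup>2)"
      using orthonormal_family_combination[OF e, of _ t]
      by (intro sum.cong) (auto simp: p_def power2_eq_square)
    finally show ?thesis .
  qed
  ultimately show "norm (\<Sum>l<m. t l *\<^sub>R (\<Sum>i<n. e l i *\<^sub>R y i)) \<le> sqrt (\<Sum>l<m. (t l)\<^sup>2)"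
    using l2_contractiveD[OF y, of p] by simp
qed

lemma dvoretzky_rogers:
  assumes "\<nexists>B :: 'a :: real_normed_vector set. finite B \<and> span B = UNIV"
  obtains x :: "nat \<Rightarrow> 'a :: real_normed_vector" where "l2_contractive k x" "\<And>i. i < k \<Longrightarrow> 1 / 4 \<le> norm (x i)"
proof -
  \<comment> \<open>With dimension \<open>2 * k\<close>, stretching by \<open>sqrt 8\<close>
    multiplies determinants by \<open>8 ^ k\<close>, which outweighs the loss of a factor 4 in each
    of fewer than \<open>k\<close> directions.\<close>
  define n where "n = 2 * k"
  obtain B :: "'a set" where B: "finite B" "independent B" "card B = n"
    using infinite_dimensional_independent[OF assms] .
  obtain D C y0 where D: "volume_form n (span B) D" and
    D_le: "\<forall>y. (\<forall>j<n. y j \<in> span B \<and> norm (y j) \<le> 1) \<longrightarrow> \<bar>D y\<bar> \<le> C" and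
    y0: "\<forall>j<n. y0 j \<in> span B" "D y0 = 1"
    using ex_volume_form[OF B] by blast
  define K where "K = {y. l2_contractive n y \<and> (\<forall>j<n. y j \<in> span B)}"
  have bdd: "bdd_above ((\<lambda>y. \<bar>D y\<bar>) ` K)"
    by (intro bdd_aboveI2[of _ _ C] D_le[rule_format])
      (auto simp: K_def intro: l2_contractive_norm_le)
  define S where "S = (SUP y\<in>K. \<bar>D y\<bar>)"
  have le_S: "\<bar>D y\<bar> \<le> S" if "y \<in> K" for y
    unfolding S_def using bdd that by (intro cSUP_upper)
  have "K \<noteq> {} \<and> S > 0"
  proof -
    \<comment> \<open>With this factor the scaled vectors have norms summing to at most 1, which
      suffices because every coordinate of \<open>t\<close> is at most its Euclidean norm. The
      summand 1 keeps the denominator positive.\<close>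
    define r where "r = 1 / (1 + (\<Sum>j<n. norm (y0 j)))"
    have pos: "1 + (\<Sum>j<n. norm (y0 j)) > 0"
      by (simp add: sum_nonneg add_pos_nonneg)
    then have r: "r > 0" "r * (\<Sum>j<n. norm (y0 j)) \<le> 1"
      by (auto simp: r_def)
    have "l2_contractive n (\<lambda>j. r *\<^sub>R y0 j)"
      unfolding l2_contractive_def
    proof
      fix t :: "nat \<Rightarrow> real"
      define u where "u = sqrt (\<Sum>i<n. (t i)\<^sup>2)"
      have "\<bar>t i\<bar> \<le> u" if "i < n" for i
        unfolding u_def using that
        by (intro real_le_rsqrt) (auto intro!: member_le_sum[where f = "\<lambda>i. (t i)\<^sup>2"])
      then have "norm (\<Sum>i<n. t i *\<^sub>R r *\<^sub>R y0 i) \<le> (\<Sum>i<n. u * (r * norm (y0 i)))"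
        using r by (intro sum_norm_le) (auto intro!: mult_right_mono simp: abs_mult)
      also have "\<dots> = u * (r * (\<Sum>i<n. norm (y0 i)))"
        by (simp add: sum_distrib_left)
      also have "\<dots> \<le> u * 1"
        using r by (intro mult_left_mono) (auto simp: u_def sum_nonneg)
      finally show "norm (\<Sum>i<n. t i *\<^sub>R r *\<^sub>R y0 i) \<le> sqrt (\<Sum>i<n. (t i)\<^sup>2)"
        by (simp add: u_def)
    qed
    then have r_K: "(\<lambda>j. r *\<^sub>R y0 j) \<in> K"
      using y0 by (auto simp: K_def span_scale)
    have "D (\<lambda>j. r *\<^sub>R y0 j) = r ^ n"
      using volume_form_scale[OF D] y0 by simp
    then have "r ^ n \<le> S"
      using le_S[OF r_K] by simp
    then have "S > 0"
      using zero_less_power[OF r(1), of n] by linarith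
    then show ?thesis
      using r_K by blast
  qed
  \<comment> \<open>Because \<open>S\<close> is positive, some \<open>y\<close> exceeds
    \<open>S / 2\<close>; a near-maximiser avoids any compactness argument.\<close>
  then have K: "K \<noteq> {}" "S / 2 < (SUP y\<in>K. \<bar>D y\<bar>)"
    by (auto simp flip: S_def)
  then obtain y where y: "y \<in> K" "S / 2 < \<bar>D y\<bar>"
    using less_cSUP_iff[OF K(1) bdd] by blast
  have yB: "\<And>j. j < n \<Longrightarrow> y j \<in> span B" and yc: "l2_contractive n y"
    using y by (auto simp: K_def)
  have step: "\<exists>q. (\<forall>l<m. (\<Sum>i<n. q i * e l i) = 0) \<and>
      1 / 4 * sqrt (\<Sum>i<n. (q i)\<^sup>2) < norm (\<Sum>i<n. q i *\<^sub>R y i)"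
    if e: "orthonormal_family n m e" and m: "m < k" for m e
  proof (rule ccontr)
    assume *: "\<not> ?thesis"
    define y' where "y' j = y j + (\<Sum>l<m. (- (3 / 4) * e l j) *\<^sub>R (\<Sum>k<n. e l k *\<^sub>R y k))" for j
    have y'B: "y' j \<in> span B" if "j < n" for j
      unfolding y'_def using yB that by (intro span_add span_sum span_scale) auto
    have "l2_contractive n (\<lambda>j. sqrt 8 *\<^sub>R y' j)"
      unfolding y'_def using * by (intro l2_contractive_stretch yc e) (auto simp: not_less)
    then have "(\<lambda>j. sqrt 8 *\<^sub>R y' j) \<in> K"
      using y'B by (auto simp: K_def span_scale)
    then have "\<bar>D (\<lambda>j. sqrt 8 *\<^sub>R y' j)\<bar> \<le> S"
      by (rule le_S)
    moreover have "D (\<lambda>j. sqrt 8 *\<^sub>R y' j) = sqrt 8 ^ n * D y'"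
      using D y'B by (rule volume_form_scale)
    moreover have "D y' = (1 / 4) ^ m * D y"
      using volume_orthonormal_update[OF D _ e, of y "- (3 / 4)"] yB by (simp add: y'_def[abs_def])
    ultimately have "8 ^ k * (1 / 4) ^ m * \<bar>D y\<bar> \<le> S"
      by (simp add: abs_mult n_def power_mult)
    \<comment> \<open>A gain of 2 contradicts the choice of \<open>y\<close>, as
      \<open>2 * \<bar>D y\<bar>\<close> already exceeds \<open>S\<close>. It follows from
      \<open>m + 1 \<le> k\<close>.\<close>
    moreover have "2 \<le> (8 :: real) ^ k * (1 / 4) ^ m"
    proof -
      have "(2 :: real) * 4 ^ m \<le> 8 * 8 ^ m"
        by (intro mult_mono power_mono) auto
      also have "\<dots> = 8 ^ Suc m" by simp
      also have "\<dots> \<le> 8 ^ k"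
        using m by (intro power_increasing) auto
      finally show ?thesis
        by (simp add: field_simps power_divide)
    qed
    then have "2 * \<bar>D y\<bar> \<le> 8 ^ k * (1 / 4) ^ m * \<bar>D y\<bar>"
      by (intro mult_right_mono) auto
    ultimately show False
      using y by linarith
  qed
  have "\<exists>e. orthonormal_family n m e \<and> (\<forall>l<m. 1 / 4 \<le> norm (\<Sum>i<n. e l i *\<^sub>R y i))" if "m \<le> k" for m
    using that
  proof (induction m)
    case 0
    then show ?case by (auto simp: orthonormal_family_def)
  next
    case (Suc m)
    then obtain e where e: "orthonormal_family n m e" and
      e_large: "\<forall>l<m. 1 / 4 \<le> norm (\<Sum>i<n. e l i *\<^sub>R y i)"
      by auto
    obtain q where q: "\<And>l. l < m \<Longrightarrow> (\<Sum>i<n. q i * e l i) = 0" and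
      q_large: "1 / 4 * sqrt (\<Sum>i<n. (q i)\<^sup>2) < norm (\<Sum>i<n. q i *\<^sub>R y i)"
      using step[OF e] Suc.prems by auto
    define s where "s = sqrt (\<Sum>i<n. (q i)\<^sup>2)"
    \<comment> \<open>The strict inequality in \<open>q_large\<close> excludes \<open>q = 0\<close>,
      so \<open>q\<close> can be normalised and appended to the family.\<close>
    have "s \<noteq> 0"
    proof
      assume "s = 0"
      then have "\<And>i. i < n \<Longrightarrow> q i = 0"
        by (simp add: s_def sum_nonneg_eq_0_iff)
      then show False
        using q_large by simp
    qed
    moreover have "s \<ge> 0"
      by (simp add: s_def sum_nonneg)
    ultimately have s: "s > 0" by simp
    have s2: "(\<Sum>i<n. q i * q i) = s * s"
      by (simp add: s_def sum_nonneg power2_eq_square)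
    define e' where "e' = (\<lambda>l i. if l = m then q i / s else e l i)"
    have "(\<Sum>i<n. q i / s * e l i) = 0" "(\<Sum>i<n. e l i * (q i / s)) = 0" if "l < m" for l
      using q[OF that] s by (simp_all add: mult.commute flip: sum_divide_distrib)
    moreover have "(\<Sum>i<n. q i / s * (q i / s)) = 1"
      using s2 s by (simp flip: sum_divide_distrib)
    ultimately have "orthonormal_family n (Suc m) e'"
      using e unfolding orthonormal_family_def e'_def by (auto simp: less_Suc_eq)
    moreover have "1 / 4 \<le> norm (\<Sum>i<n. (q i / s) *\<^sub>R y i)"
    proof -
      have "(\<Sum>i<n. (q i / s) *\<^sub>R y i) = (1 / s) *\<^sub>R (\<Sum>i<n. q i *\<^sub>R y i)"
        by (simp add: scaleR_sum_right)
      then show ?thesis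
        using q_large s by (simp add: field_simps flip: s_def)
    qed
    then have "\<forall>l<Suc m. 1 / 4 \<le> norm (\<Sum>i<n. e' l i *\<^sub>R y i)"
      using e_large by (auto simp: e'_def less_Suc_eq)
    ultimately show ?case by blast
  qed
  then obtain e where "orthonormal_family n k e" "\<forall>l<k. 1 / 4 \<le> norm (\<Sum>i<n. e l i *\<^sub>R y i)"
    by blast
  then show ?thesis
    using l2_contractive_combination[OF yc] that by blast
qed

subsection \<open>Functionals and dyadic sums\<close>

text \<open>A complex span is also a real subspace, so a finite set spanning over the reals would
  span over the complex numbers.\<close>

lemma real_infinite_dimensional:
  assumes "infinite_dimensional TYPE('a :: complex_banach)"
  shows "\<nexists>B :: 'a set. finite B \<and> span B = UNIV"
proof
  assume "\<exists>B :: 'a set. finite B \<and> span B = UNIV"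
  then obtain B :: "'a set" where B: "finite B" "span B = UNIV" by blast
  interpret C: vector_space "scaleC :: complex \<Rightarrow> 'a \<Rightarrow> 'a"
    by (rule vector_space_scaleC)
  have "subspace (C.span B)"
    by (rule real_vector.subspaceI)
      (auto simp: scaleR_scaleC C.span_zero C.span_add C.span_scale)
  then have "span B \<subseteq> C.span B"
    by (intro span_minimal C.span_superset)
  then show False
    using assms B by (auto simp: infinite_dimensional_def)
qed

lemma topological_dual_bounded_linear:
  assumes "f \<in> topological_dual"
  shows "bounded_linear f"
proof -
  interpret f: Vector_Spaces.linear "scaleC :: complex \<Rightarrow> 'a \<Rightarrow> 'a" "(*)" f
    using assms by (simp add: topological_dual_def)
  have add: "f (x + y) = f x + f y" and scale: "f (r *\<^sub>R x) = r *\<^sub>R f x" for x y r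
    by (simp_all add: f.add f.scale scaleR_scaleC scaleR_conv_of_real)
  have "isCont f 0"
    using assms by (simp add: topological_dual_def continuous_on_eq_continuous_at)
  then have "\<exists>d>0. \<forall>x. norm x < d \<longrightarrow> norm (f x) < 1"
    by (auto simp: continuous_at_eps_delta f.zero dest: spec[of _ 1])
  then obtain d where d: "d > 0" "\<And>x. norm x < d \<Longrightarrow> norm (f x) < 1"
    by blast
  have "norm (f x) \<le> norm x * (2 / d)" for x
  proof (cases "x = 0")
    case False
    \<comment> \<open>Rescaling \<open>x\<close> to norm \<open>d / 2\<close> puts it strictly
      inside the ball of radius \<open>d\<close>; hence the constant \<open>2 / d\<close>.\<close>
    have "norm (f ((d / 2 / norm x) *\<^sub>R x)) < 1"
      using d False by (intro d(2)) simp
    then show ?thesis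
      using d False by (simp add: scale field_simps)
  qed (simp add: f.zero)
  then show ?thesis
    by (intro bounded_linear_intro add scale)
qed

text \<open>Choosing the signs of the coefficients to be those of \<open>g (y i)\<close> gives the \<open>l\<^sub>1\<close> norm.\<close>

lemma l2_contractive_sum_abs_functional:
  fixes g :: "'a :: real_normed_vector \<Rightarrow> real"
  assumes y: "l2_contractive n y" and g: "bounded_linear g" and M: "\<And>x. \<bar>g x\<bar> \<le> M * norm x" "0 \<le> M"
  shows "(\<Sum>i<n. \<bar>g (y i)\<bar>) \<le> M * sqrt n"
proof -
  interpret g: bounded_linear g by (rule g)
  define t where "t i = sgn (g (y i))" for i
  have "(\<Sum>i<n. \<bar>g (y i)\<bar>) = g (\<Sum>i<n. t i *\<^sub>R y i)"
    by (simp add: g.sum g.scaleR t_def abs_sgn mult.commute)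
  also have "\<dots> \<le> M * norm (\<Sum>i<n. t i *\<^sub>R y i)"
    using M(1) abs_le_D1 by blast
  also have "\<dots> \<le> M * sqrt (\<Sum>i<n. (t i)\<^sup>2)"
    using y M by (intro mult_left_mono l2_contractiveD)
  also have "\<dots> \<le> M * sqrt (\<Sum>i<n. 1)"
    using M by (intro mult_left_mono real_sqrt_le_mono sum_mono) (auto simp: t_def sgn_if)
  finally show ?thesis by simp
qed

text \<open>Contractivity concerns real coefficients only, so real and imaginary parts are estimated
  separately; this costs the factor 2.\<close>

lemma l2_contractive_sum_norm_functional:
  fixes f :: "'a :: real_normed_vector \<Rightarrow> complex"
  assumes y: "l2_contractive n y" and f: "bounded_linear f"
    and M: "\<And>x. norm (f x) \<le> M * norm x" "0 \<le> M"
  shows "(\<Sum>i<n. norm (f (y i))) \<le> 2 * M * sqrt n"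
proof -
  have "(\<Sum>i<n. norm (f (y i))) \<le> (\<Sum>i<n. \<bar>Re (f (y i))\<bar> + \<bar>Im (f (y i))\<bar>)"
    by (intro sum_mono cmod_le)
  also have "\<dots> = (\<Sum>i<n. \<bar>Re (f (y i))\<bar>) + (\<Sum>i<n. \<bar>Im (f (y i))\<bar>)"
    by (rule sum.distrib)
  also have "\<dots> \<le> M * sqrt n + M * sqrt n"
    using f M by (intro add_mono l2_contractive_sum_abs_functional[OF y])
      (auto intro: order_trans[OF abs_Re_le_cmod] order_trans[OF abs_Im_le_cmod]
        bounded_linear_compose[OF bounded_linear_Re] bounded_linear_compose[OF bounded_linear_Im])
  finally show ?thesis by simp
qed

section \<open>Sums over dyadic blocks\<close>

lemma sum_dyadic_blocks:
  fixes g :: "nat \<Rightarrow> 'a :: comm_monoid_add"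
  shows "(\<Sum>n\<in>{1..<2 ^ K}. g n) = (\<Sum>k<K. \<Sum>i<2 ^ k. g (2 ^ k + i))"
proof (induction K)
  case (Suc K)
  have "(\<Sum>n\<in>{1..<2 ^ Suc K}. g n) = (\<Sum>n\<in>{1..<2 ^ K}. g n) + (\<Sum>n\<in>{2 ^ K..<2 ^ Suc K}. g n)"
    by (intro sum.atLeastLessThan_concat[symmetric]) auto
  also have "(\<Sum>n\<in>{2 ^ K..<2 ^ Suc K}. g n) = (\<Sum>i<2 ^ K. g (2 ^ K + i))"
    using sum.shift_bounds_nat_ivl[of g 0 "2 ^ K" "2 ^ K"]
    by (simp add: mult_2 add.commute lessThan_atLeast0)
  finally show ?case
    using Suc.IH by simp
qed simp

lemma summable_dyadic_blocks:
  fixes g :: "nat \<Rightarrow> real"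
  assumes nonneg: "\<And>n. 0 \<le> g n" and blocks: "\<And>k. (\<Sum>i<2 ^ k. g (2 ^ k + i)) \<le> C * q ^ k"
    and q: "0 \<le> q" "q < 1"
  shows "summable (\<lambda>n. g (Suc n))"
proof (rule summableI_nonneg_bounded[where x = "C * (1 / (1 - q))"])
  fix N
  \<comment> \<open>Block 0 bounds a nonnegative sum by \<open>C * q ^ 0\<close>, which is
    \<open>C\<close>.\<close>
  have "0 \<le> C"
    using order_trans[OF sum_nonneg blocks[of 0]] nonneg by simp
  have "(\<Sum>n<N. g (Suc n)) = (\<Sum>n\<in>{1..<Suc N}. g n)"
    using sum.shift_bounds_Suc_ivl[of g 0 N] by (simp add: lessThan_atLeast0)
  \<comment> \<open>As \<open>N < 2 ^ N\<close>, the indices up to \<open>N\<close> lie in the first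
    \<open>N\<close> blocks.\<close>
  also have "\<dots> \<le> (\<Sum>n\<in>{1..<2 ^ N}. g n)"
    using Suc_leI[OF less_exp[of N]] nonneg by (intro sum_mono2 ivl_subset[THEN iffD2]) auto
  also have "\<dots> \<le> (\<Sum>k<N. C * q ^ k)"
    unfolding sum_dyadic_blocks using blocks by (intro sum_mono)
  also have "\<dots> = C * (\<Sum>k<N. q ^ k)"
    by (simp add: sum_distrib_left)
  also have "(\<Sum>k<N. q ^ k) \<le> (\<Sum>k. q ^ k)"
    using q by (intro sum_le_suminf summable_geometric) auto
  also have "(\<Sum>k. q ^ k) = 1 / (1 - q)"
    using q by (intro suminf_geometric) auto
  finally show "(\<Sum>n<N. g (Suc n)) \<le> C * (1 / (1 - q))"
    using \<open>0 \<le> C\<close> by (simp add: mult_left_mono)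
qed (rule nonneg)

subsection \<open>The Dirichlet series\<close>

text \<open>Row \<open>k\<close> contributes its first \<open>2 ^ k\<close> entries, so the rows
  tile the positive integers. Index 0 receives \<open>x 0 0\<close>, which the abscissas never
  read.\<close>

definition dyadic_concat :: "(nat \<Rightarrow> nat \<Rightarrow> 'a) \<Rightarrow> nat \<Rightarrow> 'a" where
  "dyadic_concat x n = x (floor_log n) (n - 2 ^ floor_log n)"

lemma dyadic_concat_block: "i < 2 ^ k \<Longrightarrow> dyadic_concat x (2 ^ k + i) = x k i"
  unfolding dyadic_concat_def by (subst (1 2) floor_log_eqI[of _ k]) auto

lemma dyadic_concat_cases:
  fixes n :: nat
  assumes "n > 0"
  obtains k i where "i < 2 ^ k" "n = 2 ^ k + i"
proof
  show "n = 2 ^ floor_log n + (n - 2 ^ floor_log n)"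
    using floor_log_exp2_le[OF assms] by simp
  show "n - 2 ^ floor_log n < 2 ^ floor_log n"
    using floor_log_exp2_gt[of n] floor_log_exp2_le[OF assms] by linarith
qed

lemma norm_Suc_powr: "cmod (of_nat (Suc n) powr s) = real (Suc n) powr Re s"
  using norm_powr_real_powr[of "of_nat (Suc n)" s] by simp

text \<open>Comparison with the zeta series. It makes the constructed series admissible in the
  supremum defining the gap.\<close>

lemma sigma_c_le_one:
  fixes a :: "nat \<Rightarrow> 'a :: complex_banach"
  assumes "\<And>n. n > 0 \<Longrightarrow> norm (a n) \<le> 1"
  shows "sigma_c a \<le> 1"
proof -
  have "summable (\<lambda>n. (1 / of_nat (Suc n) powr s) *\<^sub>C a (Suc n))" if "Re s > 1" for s
  proof (rule summable_comparison_test')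
    have "summable (\<lambda>n. real n powr - Re s)"
      using that by (subst summable_real_powr_iff) simp
    then show "summable (\<lambda>n. real (Suc n) powr - Re s)"
      by (subst summable_Suc_iff)
    show "norm ((1 / of_nat (Suc n) powr s) *\<^sub>C a (Suc n)) \<le> real (Suc n) powr - Re s" for n
      using assms[of "Suc n"] mult_left_le[of "norm (a (Suc n))" "real (Suc n) powr - Re s"]
      by (simp only: norm_scaleC norm_divide norm_Suc_powr powr_minus_divide norm_one) simp
  qed
  then show ?thesis
    unfolding sigma_c_def one_ereal_def by (intro Inf_lower) blast
qed

text \<open>Any admissible \<open>r < 1\<close> would allow \<open>s = 1\<close>, where the terms
  dominate a positive multiple of the harmonic series.\<close>

lemma one_le_sigma_a:
  fixes a :: "nat \<Rightarrow> 'a :: real_normed_vector"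
  assumes "c > 0" "\<And>n. n > 0 \<Longrightarrow> c \<le> norm (a n)"
  shows "1 \<le> sigma_a a"
  unfolding sigma_a_def
proof (rule Inf_greatest, clarify)
  fix r assume r: "\<forall>s. r < Re s \<longrightarrow> summable (\<lambda>n. norm (a (Suc n)) * cmod (of_nat (Suc n) powr - s))"
  show "1 \<le> ereal r"
  proof (rule ccontr)
    assume "\<not> 1 \<le> ereal r"
    then have "r < Re 1" by simp
    then have "summable (\<lambda>n. norm (a (Suc n)) * cmod (of_nat (Suc n) powr - 1))"
      using r by blast
    then have "summable (\<lambda>n. c * real (Suc n) powr - 1)"
      using assms by (elim summable_comparison_test'[where N = 0])
        (auto simp: norm_Suc_powr simp del: of_nat_Suc intro!: divide_right_mono)
    then have "summable (\<lambda>n. real n powr - 1)"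
      using assms by (subst (asm) summable_cmult_iff, subst (asm) summable_Suc_iff) auto
    then show False
      by (subst (asm) summable_real_powr_iff) simp
  qed
qed

lemma sigma_a_weak_dyadic_le_half:
  fixes x :: "nat \<Rightarrow> nat \<Rightarrow> 'a :: complex_banach"
  assumes x: "\<And>k. l2_contractive (2 ^ k) (x k)"
  shows "sigma_a_weak (dyadic_concat x) \<le> ereal (1 / 2)"
  unfolding sigma_a_weak_def
proof (rule SUP_least)
  fix f :: "'a \<Rightarrow> complex" assume "f \<in> topological_dual"
  then have f: "bounded_linear f"
    by (rule topological_dual_bounded_linear)
  obtain M where M: "0 \<le> M" "\<And>x. norm (f x) \<le> M * norm x"
    using bounded_linear.nonneg_bounded[OF f] by (auto simp: mult.commute)
  have "summable (\<lambda>n. norm (f (dyadic_concat x (Suc n))) * cmod (of_nat (Suc n) powr - s))"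
    if s: "Re s > 1 / 2" for s
  proof -
    define g where "g n = norm (f (dyadic_concat x n)) * real n powr - Re s" for n
    have "summable (\<lambda>n. g (Suc n))"
    proof (rule summable_dyadic_blocks)
      fix k
      have "(\<Sum>i<2 ^ k. g (2 ^ k + i)) \<le> (\<Sum>i<2 ^ k. norm (f (x k i)) * (2 powr - Re s) ^ k)"
      proof (rule sum_mono)
        fix i :: nat assume "i \<in> {..<2 ^ k}"
        \<comment> \<open>On a block the weight is largest at the first index, and there it is a
          \<open>k\<close>-th power, as the geometric bound requires.\<close>
        moreover have "real (2 ^ k + i) powr - Re s \<le> real (2 ^ k) powr - Re s"
          using s by (intro powr_mono2') auto
        moreover have "real (2 ^ k) powr - Re s = (2 powr - Re s) ^ k"
          by (simp add: powr_powr mult.commute flip: powr_realpow)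
        ultimately show "g (2 ^ k + i) \<le> norm (f (x k i)) * (2 powr - Re s) ^ k"
          by (simp add: g_def dyadic_concat_block mult_left_mono)
      qed
      also have "\<dots> = (\<Sum>i<2 ^ k. norm (f (x k i))) * (2 powr - Re s) ^ k"
        by (simp add: sum_distrib_right)
      also have "\<dots> \<le> (2 * M * sqrt (2 ^ k)) * (2 powr - Re s) ^ k"
        using l2_contractive_sum_norm_functional[OF x f M(2,1)]
        by (intro mult_right_mono) auto
      also have "\<dots> = 2 * M * (sqrt 2 * 2 powr - Re s) ^ k"
        by (simp add: real_sqrt_power power_mult_distrib)
      finally show "(\<Sum>i<2 ^ k. g (2 ^ k + i)) \<le> 2 * M * (sqrt 2 * 2 powr - Re s) ^ k" .
    next
      \<comment> \<open>The block sums grow by \<open>sqrt 2\<close> and the weights shrink by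
        \<open>2 powr - Re s\<close>; the combined ratio is below 1 exactly when
        \<open>Re s > 1 / 2\<close>.\<close>
      have "sqrt 2 * 2 powr - Re s = 2 powr (1 / 2 - Re s)"
        using powr_add[of 2 "1 / 2" "- Re s"] by (simp add: powr_half_sqrt)
      also have "\<dots> < 2 powr 0"
        using s by (intro powr_less_mono) auto
      finally show "sqrt 2 * 2 powr - Re s < 1" by simp
    qed (auto simp: g_def)
    then show ?thesis
      by (simp add: g_def norm_Suc_powr del: of_nat_Suc)
  qed
  then show "sigma_a (\<lambda>n. f (dyadic_concat x n)) \<le> ereal (1 / 2)"
    unfolding sigma_a_def by (intro Inf_lower) blast
qed

theorem proposition3p2:
  assumes "infinite_dimensional TYPE('a :: complex_banach)"
  shows "gap_absolute TYPE('a) \<ge> ereal (1 / 2)"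
proof -
  have "\<exists>y :: nat \<Rightarrow> 'a. l2_contractive (2 ^ k) y \<and> (\<forall>i<2 ^ k. 1 / 4 \<le> norm (y i))" for k
    using dvoretzky_rogers[OF real_infinite_dimensional[OF assms], of "2 ^ k"] by metis
  then obtain x :: "nat \<Rightarrow> nat \<Rightarrow> 'a" where
    x: "\<And>k. l2_contractive (2 ^ k) (x k)" "\<And>k i. i < 2 ^ k \<Longrightarrow> 1 / 4 \<le> norm (x k i)"
    by metis
  define a where "a = dyadic_concat x"
  have "norm (a n) \<le> 1" "1 / 4 \<le> norm (a n)" if n: "n > 0" for n
    using dyadic_concat_cases[OF n] l2_contractive_norm_le[OF x(1)] x(2)
    by (metis a_def dyadic_concat_block)+
  then have "sigma_c a \<le> 1" and sa: "1 \<le> sigma_a a"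
    using sigma_c_le_one[of a] one_le_sigma_a[of "1 / 4" a] by auto
  then have "sigma_c a < \<infinity>"
    by (auto simp: less_top[symmetric] top_ereal_def)
  have "ereal (1 / 2) = 1 - ereal (1 / 2)"
    by (simp add: one_ereal_def)
  also have "\<dots> \<le> sigma_a a - sigma_a_weak a"
    using sa sigma_a_weak_dyadic_le_half[of x] x(1) by (intro ereal_minus_mono) (auto simp: a_def)
  \<comment> \<open>Since \<open>sigma_a a\<close> is at least 1, the exceptional case of two
    abscissas equal to minus infinity does not occur.\<close>
  also have "\<dots> = abscissa_gap a"
    using sa by (auto simp: abscissa_gap_def)
  also have "\<dots> \<le> gap_absolute TYPE('a)"
    unfolding gap_absolute_def using \<open>sigma_c a < \<infinity>\<close> by (intro SUP_upper) simp
  finally show ?thesis .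
qed

end
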